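(* For a fixed BDAM instance and a fixed defender plan $(X,y)$ (in the notation of the context), the threat corridor $C(X,y)$ is uniquely determined, i.e. it is a function of the instance and $(X,y)$ alone. Therefore the corridor supply lengths $\delta^D_C$, and the resulting supply cost $D_U$ (for a given assignment of wards to supply nodes), are independent of any tie-breaking among the attacker's optimal paths: whichever attacker-optimal $s$-$t$ path $P$ a shortest-path routine selects, the same $C(X,y)$, the same $\delta^D_C$ and the same $D_U$ result.
   Context: A BDAM (bi-level dual-defense attacker model) instance consists of a finite undirected graph $G=(V,E)$ with positive edge lengths $d(u,v)=d(v,u)>0$, distinct nodes $s$ (source) and $t$ (terminal) with $t$ reachable from $s$, a set of supply nodes, and weights $g_1,g_2\ge0$. A defender plan $(X,y)$ consists of binary $X_v$ ($v\in V$; $X_v=1$ means $v$ is interdicted, and $v$ is then called a ward) and binary $y(u,v)=y(v,u)$ ($\{u,v\}\in E$; edge destruction). Each ward is assigned to one supply node. Attacker lengths: traversing edge $\{u,v\}$ from $u$ to $v$ costs $\delta^A(u,v)=d(u,v)(1+g_1X_v+g_2\,y(u,v))$. Under $\delta^A$ let $d_s(v)$ be the shortest distance from $s$ to $v$, $d_t(v)$ the shortest distance from $v$ to $t$, and $L_0=d_s(t)$. An attacker-optimal path is an $s$-$t$ path of length $L_0$ under $\delta^A$; it need not be unique (ties). Threat corridor: $C(X,y)$ is the set of edges $\{u,v\}\in E$ such that $$d_s(u)+\delta^A(u,v)+d_t(v)=L_0\quad\text{or}\quad d_s(v)+\delta^A(v,u)+d_t(u)=L_0 .$$ Corridor supply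 lengths: $\delta^D_C(i,j)=d(i,j)(1+g_2\,y(i,j))$ if $\{i,j\}\notin C(X,y)$, and $\delta^D_C(i,j)=\infty$ if $\{i,j\}\in C(X,y)$. Supply cost: $D_U$ is the sum over wards of the shortest-path distance under $\delta^D_C$ from the assigned supply node to the ward, where a ward with no finite route is charged a penalty constant $M$ ($M=10^6$). *)

theory Defs
  imports
    "Graph_Theory.Pair_Digraph"
    "Graph_Theory.Shortest_Path"
begin

text \<open>An undirected edge \<open>{u, v}\<close> is represented by the two arcs \<open>(u, v)\<close> and \<open>(v, u)\<close>
  of a finite, symmetric, loop-free digraph. Only the values of the length function on arcs matter.\<close>

record 'v bdam =
  network :: "'v pair_pre_digraph"
  len :: "'v \<Rightarrow> 'v \<Rightarrow> real"
  source :: 'v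
  terminal :: 'v
  supply_nodes :: "'v set"
  g1 :: real
  g2 :: real

definition bdam_instance :: "'v bdam \<Rightarrow> bool" where
  "bdam_instance I \<longleftrightarrow>
     pair_graph (network I) \<and>
     (\<forall>(u, v) \<in> parcs (network I). len I u v > 0 \<and> len I u v = len I v u) \<and>
     source I \<in> pverts (network I) \<and> terminal I \<in> pverts (network I) \<and>
     source I \<noteq> terminal I \<and>
     reachable (with_proj (network I)) (source I) (terminal I) \<and>
     supply_nodes I \<subseteq> pverts (network I) \<and>
     g1 I \<ge> 0 \<and> g2 I \<ge> 0"

definition defender_plan :: "'v bdam \<Rightarrow> ('v \<Rightarrow> bool) \<Rightarrow> ('v \<Rightarrow> 'v \<Rightarrow> bool) \<Rightarrow> bool" where
  "defender_plan I X y \<longleftrightarrow> (\<forall>(u, v) \<in> parcs (network I). y u v = y v u)"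

definition wards :: "'v bdam \<Rightarrow> ('v \<Rightarrow> bool) \<Rightarrow> 'v set" where
  "wards I X = {v \<in> pverts (network I). X v}"

definition supply_assignment :: "'v bdam \<Rightarrow> ('v \<Rightarrow> bool) \<Rightarrow> ('v \<Rightarrow> 'v) \<Rightarrow> bool" where
  "supply_assignment I X a \<longleftrightarrow> (\<forall>v \<in> wards I X. a v \<in> supply_nodes I)"

definition attacker_length ::
  "'v bdam \<Rightarrow> ('v \<Rightarrow> bool) \<Rightarrow> ('v \<Rightarrow> 'v \<Rightarrow> bool) \<Rightarrow> ('v \<times> 'v) weight_fun" where
  "attacker_length I X y =
     (\<lambda>(u, v). len I u v * (1 + g1 I * of_bool (X v) + g2 I * of_bool (y u v)))"

definition attacker_dist ::
  "'v bdam \<Rightarrow> ('v \<Rightarrow> bool) \<Rightarrow> ('v \<Rightarrow> 'v \<Rightarrow> bool) \<Rightarrow> 'v \<Rightarrow> 'v \<Rightarrow> ereal" where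
  "attacker_dist I X y u v = wf_digraph.\<mu> (with_proj (network I)) (attacker_length I X y) u v"

definition attacker_shortest_path ::
  "'v bdam \<Rightarrow> ('v \<Rightarrow> bool) \<Rightarrow> ('v \<Rightarrow> 'v \<Rightarrow> bool) \<Rightarrow> 'v \<Rightarrow> ('v \<times> 'v) awalk \<Rightarrow> 'v \<Rightarrow> bool" where
  "attacker_shortest_path I X y u p v \<longleftrightarrow>
     pre_digraph.apath (with_proj (network I)) u p v \<and>
     ereal (wf_digraph.awalk_cost (attacker_length I X y) p) = attacker_dist I X y u v"

definition attacker_optimal_path ::
  "'v bdam \<Rightarrow> ('v \<Rightarrow> bool) \<Rightarrow> ('v \<Rightarrow> 'v \<Rightarrow> bool) \<Rightarrow> ('v \<times> 'v) awalk \<Rightarrow> bool" where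
  "attacker_optimal_path I X y P \<longleftrightarrow> attacker_shortest_path I X y (source I) P (terminal I)"

definition tight_edges ::
  "'v pair_pre_digraph \<Rightarrow> ('v \<times> 'v) weight_fun \<Rightarrow> ('v \<Rightarrow> ereal) \<Rightarrow> ('v \<Rightarrow> ereal) \<Rightarrow> ereal
    \<Rightarrow> 'v set set" where
  "tight_edges G w ds dt L =
     {{u, v} | u v. (u, v) \<in> parcs G \<and>
        (ds u + ereal (w (u, v)) + dt v = L \<or> ds v + ereal (w (v, u)) + dt u = L)}"

definition threat_corridor ::
  "'v bdam \<Rightarrow> ('v \<Rightarrow> bool) \<Rightarrow> ('v \<Rightarrow> 'v \<Rightarrow> bool) \<Rightarrow> 'v set set" where
  "threat_corridor I X y =
     tight_edges (network I) (attacker_length I X y)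
       (\<lambda>v. attacker_dist I X y (source I) v) (\<lambda>v. attacker_dist I X y v (terminal I))
       (attacker_dist I X y (source I) (terminal I))"

text \<open>The output of a shortest-path routine, with arbitrary tie-breaking: besides an
  attacker-optimal path it consists of one selected shortest path from the source to every node
  (\<open>Ps\<close>) and from every node to the terminal (\<open>Pt\<close>), where \<open>None\<close> reports that there is no path.
  The distance labels and \<open>L\<^sub>0\<close> are then read off as the lengths of the selected paths.\<close>

definition valid_selection ::
  "'v bdam \<Rightarrow> ('v \<Rightarrow> bool) \<Rightarrow> ('v \<Rightarrow> 'v \<Rightarrow> bool) \<Rightarrow> 'v \<Rightarrow> ('v \<times> 'v) awalk option \<Rightarrow> 'v \<Rightarrow> bool" where
  "valid_selection I X y u sel v \<longleftrightarrow>
     (case sel of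
        None \<Rightarrow> \<not> reachable (with_proj (network I)) u v
      | Some p \<Rightarrow> attacker_shortest_path I X y u p v)"

definition routine_labels ::
  "'v bdam \<Rightarrow> ('v \<Rightarrow> bool) \<Rightarrow> ('v \<Rightarrow> 'v \<Rightarrow> bool)
    \<Rightarrow> ('v \<Rightarrow> ('v \<times> 'v) awalk option) \<Rightarrow> ('v \<Rightarrow> ('v \<times> 'v) awalk option) \<Rightarrow> bool" where
  "routine_labels I X y Ps Pt \<longleftrightarrow>
     (\<forall>v \<in> pverts (network I).
        valid_selection I X y (source I) (Ps v) v \<and> valid_selection I X y v (Pt v) (terminal I))"

definition selected_length :: "('v \<times> 'v) weight_fun \<Rightarrow> ('v \<times> 'v) awalk option \<Rightarrow> ereal" where
  "selected_length w sel =
     (case sel of None \<Rightarrow> \<infinity> | Some p \<Rightarrow> ereal (wf_digraph.awalk_cost w p))"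

definition routine_corridor ::
  "'v bdam \<Rightarrow> ('v \<Rightarrow> bool) \<Rightarrow> ('v \<Rightarrow> 'v \<Rightarrow> bool) \<Rightarrow> ('v \<times> 'v) awalk
    \<Rightarrow> ('v \<Rightarrow> ('v \<times> 'v) awalk option) \<Rightarrow> ('v \<Rightarrow> ('v \<times> 'v) awalk option) \<Rightarrow> 'v set set" where
  "routine_corridor I X y P Ps Pt =
     tight_edges (network I) (attacker_length I X y)
       (\<lambda>v. selected_length (attacker_length I X y) (Ps v))
       (\<lambda>v. selected_length (attacker_length I X y) (Pt v))
       (ereal (wf_digraph.awalk_cost (attacker_length I X y) P))"

definition supply_length ::
  "'v bdam \<Rightarrow> ('v \<Rightarrow> 'v \<Rightarrow> bool) \<Rightarrow> 'v set set \<Rightarrow> 'v \<times> 'v \<Rightarrow> ereal" where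
  "supply_length I y C =
     (\<lambda>(i, j). if {i, j} \<in> C then \<infinity> else ereal (len I i j * (1 + g2 I * of_bool (y i j))))"

text \<open>The library distance only covers real-valued lengths, whereas supply lengths may be
  infinite.\<close>

definition supply_dist :: "'v bdam \<Rightarrow> ('v \<times> 'v \<Rightarrow> ereal) \<Rightarrow> 'v \<Rightarrow> 'v \<Rightarrow> ereal" where
  "supply_dist I \<delta> u v =
     (INF p \<in> {p. pre_digraph.awalk (with_proj (network I)) u p v}. sum_list (map \<delta> p))"

definition penalty :: real where
  "penalty = 10 ^ 6"

definition supply_cost ::
  "'v bdam \<Rightarrow> ('v \<Rightarrow> bool) \<Rightarrow> ('v \<times> 'v \<Rightarrow> ereal) \<Rightarrow> ('v \<Rightarrow> 'v) \<Rightarrow> real" where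
  "supply_cost I X \<delta> a =
     (\<Sum>v \<in> wards I X.
        if supply_dist I \<delta> (a v) v = \<infinity> then penalty
        else real_of_ereal (supply_dist I \<delta> (a v) v))"

end

theory Submission
  imports Defs
begin

text \<open>All selected shortest paths between two given nodes have the same length, so the labels a
  routine reads off are the distances themselves, with \<open>\<infinity>\<close> for unreachable pairs on both sides.
  Uniqueness of the corridor, as opposed to mere agreement, also needs some selection to exist:
  attacker lengths are nonnegative, so a finite network has no negative cycle and every reachable
  pair is joined by a shortest simple path.\<close>

lemma bdam_instance_fin_digraph:
  assumes "bdam_instance I"
  shows "fin_digraph (with_proj (network I))"
proof -
  interpret pair_graph "network I"
    using assms by (simp add: bdam_instance_def)
  show ?thesis by unfold_locales
qed

lemma attacker_length_nonneg:
  assumes "bdam_instance I" and "e \<in> parcs (network I)"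
  shows "attacker_length I X y e \<ge> 0"
  using assms by (fastforce simp: bdam_instance_def attacker_length_def)

text \<open>\<open>attacker_dist\<close> is an infimum over all walks, whereas a selection must be a
  simple path attaining it. The absence of closed walks of negative cost bridges the two.\<close>

lemma attacker_shortest_path_exists:
  assumes "bdam_instance I" and "reachable (with_proj (network I)) u v"
  shows "\<exists>p. attacker_shortest_path I X y u p v"
proof -
  interpret fin_digraph "with_proj (network I)"
    using assms(1) by (rule bdam_instance_fin_digraph)
  have "awalk_cost (attacker_length I X y) c \<ge> 0" if "awalk w c w" for w c
    using that attacker_length_nonneg[OF assms(1)] by (auto intro: pos_cost_pos_awalk_cost)
  then show ?thesis
    using no_neg_cyc_reach_imp_path[OF assms(2), of "attacker_length I X y"]
    unfolding attacker_shortest_path_def attacker_dist_def by (metis not_less)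
qed

text \<open>Covers arbitrary points of the type, so that \<open>choice\<close> yields total
  functions: outside the network nothing is reachable and \<open>None\<close> is valid.\<close>

lemma valid_selection_exists:
  assumes "bdam_instance I"
  shows "\<exists>sel. valid_selection I X y u sel v"
proof (cases "reachable (with_proj (network I)) u v")
  case True
  then obtain p where "attacker_shortest_path I X y u p v"
    using attacker_shortest_path_exists[OF assms] by blast
  then have "valid_selection I X y u (Some p) v"
    by (simp add: valid_selection_def)
  then show ?thesis ..
next
  case False
  then have "valid_selection I X y u None v"
    by (simp add: valid_selection_def)
  then show ?thesis ..
qed

lemma routine_labels_exist:
  assumes "bdam_instance I"
  shows "\<exists>Ps Pt. routine_labels I X y Ps Pt"
proof -
  have "\<forall>v. \<exists>sel. valid_selection I X y (source I) sel v"
    and "\<forall>v. \<exists>sel. valid_selection I X y v sel (terminal I)"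
    using valid_selection_exists[OF assms] by blast+
  then obtain Ps Pt where "\<forall>v. valid_selection I X y (source I) (Ps v) v"
    and "\<forall>v. valid_selection I X y v (Pt v) (terminal I)"
    by (auto dest!: choice)
  then show ?thesis
    unfolding routine_labels_def by blast
qed

lemma attacker_optimal_path_exists:
  assumes "bdam_instance I"
  shows "\<exists>P. attacker_optimal_path I X y P"
  unfolding attacker_optimal_path_def
  using assms by (intro attacker_shortest_path_exists) (auto simp: bdam_instance_def)

lemma selected_length_eq_attacker_dist:
  assumes "bdam_instance I" and "valid_selection I X y u sel v"
  shows "selected_length (attacker_length I X y) sel = attacker_dist I X y u v"
proof -
  interpret fin_digraph "with_proj (network I)"
    using assms(1) by (rule bdam_instance_fin_digraph)
  show ?thesis
    \<comment> \<open>\<open>shortest_path_inf\<close> settles \<open>None\<close>: an infimum over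
      no walks is infinite, like the default in \<open>selected_length\<close>.\<close>
    using assms(2) shortest_path_inf
    by (cases sel) (auto simp: valid_selection_def selected_length_def
        attacker_shortest_path_def attacker_dist_def)
qed

text \<open>Labels of a routine are constrained only at nodes of the network, so agreement may be
  required only at endpoints of arcs.\<close>

lemma tight_edges_cong:
  assumes "\<And>u v. (u, v) \<in> parcs G \<Longrightarrow> ds u = ds' u \<and> ds v = ds' v \<and> dt u = dt' u \<and> dt v = dt' v"
  shows "tight_edges G w ds dt L = tight_edges G w ds' dt' L"
  unfolding tight_edges_def using assms by (intro Collect_cong) metis

text \<open>Both sides are \<open>tight_edges\<close> of the same network and lengths, so it
  suffices to match the two label functions at nodes and the cost of \<open>P\<close> with the
  source-terminal distance.\<close>

lemma routine_corridor_eq_threat_corridor: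
  assumes I: "bdam_instance I"
    and P: "attacker_optimal_path I X y P"
    and labels: "routine_labels I X y Ps Pt"
  shows "routine_corridor I X y P Ps Pt = threat_corridor I X y"
proof -
  interpret pair_graph "network I"
    using I by (simp add: bdam_instance_def)
  have "ereal (wf_digraph.awalk_cost (attacker_length I X y) P) =
      attacker_dist I X y (source I) (terminal I)"
    using P by (simp add: attacker_optimal_path_def attacker_shortest_path_def)
  moreover have "selected_length (attacker_length I X y) (Ps v) = attacker_dist I X y (source I) v"
    and "selected_length (attacker_length I X y) (Pt v) = attacker_dist I X y v (terminal I)"
    if "v \<in> pverts (network I)" for v
    using labels that selected_length_eq_attacker_dist[OF I] by (auto simp: routine_labels_def)
  ultimately show ?thesis
    unfolding routine_corridor_def threat_corridor_def
    by (auto intro!: tight_edges_cong dest: in_arcsD1 in_arcsD2)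
qed

theorem proposition2:
  fixes I :: "'v bdam" and X :: "'v \<Rightarrow> bool" and y :: "'v \<Rightarrow> 'v \<Rightarrow> bool"
  assumes "bdam_instance I" and "defender_plan I X y"
  shows "(\<exists>!C. \<forall>P Ps Pt. attacker_optimal_path I X y P \<and> routine_labels I X y Ps Pt \<longrightarrow>
              routine_corridor I X y P Ps Pt = C) \<and>
         (\<forall>P Ps Pt. attacker_optimal_path I X y P \<and> routine_labels I X y Ps Pt \<longrightarrow>
              routine_corridor I X y P Ps Pt = threat_corridor I X y \<and>
              supply_length I y (routine_corridor I X y P Ps Pt) =
                supply_length I y (threat_corridor I X y) \<and>
              (\<forall>a. supply_assignment I X a \<longrightarrow>
                 supply_cost I X (supply_length I y (routine_corridor I X y P Ps Pt)) a =
                 supply_cost I X (supply_length I y (threat_corridor I X y)) a))"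
proof (intro conjI)
  have corridor: "routine_corridor I X y P Ps Pt = threat_corridor I X y"
    if "attacker_optimal_path I X y P \<and> routine_labels I X y Ps Pt" for P Ps Pt
    using that routine_corridor_eq_threat_corridor[OF assms(1)] by blast
  \<comment> \<open>Without such a triple the implication would hold vacuously for every
    \<open>C\<close>; a single one pins \<open>C\<close> down.\<close>
  obtain P Ps Pt where "attacker_optimal_path I X y P \<and> routine_labels I X y Ps Pt"
    using attacker_optimal_path_exists[OF assms(1)] routine_labels_exist[OF assms(1)] by blast
  then show "\<exists>!C. \<forall>P Ps Pt. attacker_optimal_path I X y P \<and> routine_labels I X y Ps Pt \<longrightarrow>
      routine_corridor I X y P Ps Pt = C"
    using corridor by (intro ex1I[of _ "threat_corridor I X y"]) metis+
  show "\<forall>P Ps Pt. attacker_optimal_path I X y P \<and> routine_labels I X y Ps Pt \<longrightarrow>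
      routine_corridor I X y P Ps Pt = threat_corridor I X y \<and>
      supply_length I y (routine_corridor I X y P Ps Pt) =
        supply_length I y (threat_corridor I X y) \<and>
      (\<forall>a. supply_assignment I X a \<longrightarrow>
         supply_cost I X (supply_length I y (routine_corridor I X y P Ps Pt)) a =
         supply_cost I X (supply_length I y (threat_corridor I X y)) a)"
    \<comment> \<open>Supply lengths and cost see the selection only through the corridor, so
      rewriting it suffices.\<close>
    by (simp add: corridor)
qed

end
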